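(* Let $\Gamma$ be a countable directed graph. The subsets $$\{\mathcal E(p):\ p\in U_{F;I}\},$$ where $I\subseteq F$ range over all finite subsets of $\Gamma_V$ with $F\ne\emptyset$, form a base for a topology of the end space $\mathcal E(\Gamma)$ which is second countable, totally disconnected and metrizable.
   Context: A countable directed graph $\Gamma$ consists of countable sets $\Gamma_V$ (vertices) and $\Gamma_{Ar}$ (arrows) with source and range maps $s,r:\Gamma_{Ar}\to\Gamma_V$ (multiple arrows and loops allowed). $P(\Gamma)$ is the set of infinite paths $p=(p_i)_{i\ge1}\in(\Gamma_{Ar})^{\mathbb N}$, $r(p_i)=s(p_{i+1})$. $\mathrm{Wan}(\Gamma)$ is the set of $p\in P(\Gamma)$ such that for each finite $H\subseteq\Gamma_V$ there is $N$ with $s(p_i)\notin H$ for all $i\ge N$. For $p,q\in\mathrm{Wan}(\Gamma)$ write $p\to q$ if for every finite $H\subseteq\Gamma_V$ and $N\in\mathbb N$ there are $n_1,n_2\ge N$ and a finite path from $s(p_{n_1})$ to $s(q_{n_2})$ none of whose vertices is in $H$ (a vertex counts as a path of length $0$). $p\sim q$ means $p\to q$ and $q\to p$; this is an equivalence relation. $\mathcal E(\Gamma)=\mathrm{Wan}(\Gamma)/\!\sim$, and $\mathcal E(p)$ is the class of $p$. For a finite non-empty $F\subseteq\Gamma_V$, $v\in F$, $w\notin F$, let $L_F(v,w)$ be the set of finite paths $a_1\cdots a_n$ from $v$ to $w$ with $r(a_i)\notin F$ for all $i\ge1$. For $p\in\mathrm{Wan}(\Gamma)$, $[F]_p$ is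 the set of $v\in F$ such that for all $N\in\mathbb N$ there is $n\ge N$ with $s(p_n)\notin F$ and $L_F(v,s(p_n))\ne\emptyset$. For finite sets $I\subseteq F$, $U_{F;I}=\{p\in\mathrm{Wan}(\Gamma):[F]_p=I\}$. Totally disconnected means that for any pair of distinct points there is an open and closed set containing one and not the other. *)

theory Defs
  imports "HOL-Analysis.Analysis" "Graph_Theory.Arc_Walk"
begin

text \<open>
  Source and range of an arrow are \<^const>\<open>tail\<close> and \<^const>\<open>head\<close>. Infinite paths
  \<open>p\<^sub>1 p\<^sub>2 \<dots>\<close> are re-indexed to start from \<open>0\<close>; the conditions imposed on them
  below only involve arbitrarily large indices, so the shift has no effect.
\<close>

definition infinite_paths :: "('a, 'b) pre_digraph \<Rightarrow> (nat \<Rightarrow> 'b) set" where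
  "infinite_paths G = {p. \<forall>i. p i \<in> arcs G \<and> head G (p i) = tail G (p (Suc i))}"

definition wandering_paths :: "('a, 'b) pre_digraph \<Rightarrow> (nat \<Rightarrow> 'b) set" where
  "wandering_paths G = {p \<in> infinite_paths G.
     \<forall>H. finite H \<and> H \<subseteq> verts G \<longrightarrow> (\<exists>N. \<forall>i\<ge>N. tail G (p i) \<notin> H)}"

definition end_le :: "('a, 'b) pre_digraph \<Rightarrow> (nat \<Rightarrow> 'b) \<Rightarrow> (nat \<Rightarrow> 'b) \<Rightarrow> bool" where
  "end_le G p q \<longleftrightarrow> (\<forall>H N. finite H \<and> H \<subseteq> verts G \<longrightarrow>
     (\<exists>n\<^sub>1\<ge>N. \<exists>n\<^sub>2\<ge>N. \<exists>es. pre_digraph.awalk G (tail G (p n\<^sub>1)) es (tail G (q n\<^sub>2)) \<and>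
        set (pre_digraph.awalk_verts G (tail G (p n\<^sub>1)) es) \<inter> H = {}))"

definition end_rel :: "('a, 'b) pre_digraph \<Rightarrow> ((nat \<Rightarrow> 'b) \<times> (nat \<Rightarrow> 'b)) set" where
  "end_rel G = {(p, q). p \<in> wandering_paths G \<and> q \<in> wandering_paths G \<and>
     end_le G p q \<and> end_le G q p}"

definition end_space :: "('a, 'b) pre_digraph \<Rightarrow> (nat \<Rightarrow> 'b) set set" where
  "end_space G = wandering_paths G // end_rel G"

definition end_of :: "('a, 'b) pre_digraph \<Rightarrow> (nat \<Rightarrow> 'b) \<Rightarrow> (nat \<Rightarrow> 'b) set" where
  "end_of G p = end_rel G `` {p}"

definition leaving_walks :: "('a, 'b) pre_digraph \<Rightarrow> 'a set \<Rightarrow> 'a \<Rightarrow> 'a \<Rightarrow> 'b list set" where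
  "leaving_walks G F v w = {es. pre_digraph.awalk G v es w \<and> (\<forall>e\<in>set es. head G e \<notin> F)}"

definition exits_towards :: "('a, 'b) pre_digraph \<Rightarrow> 'a set \<Rightarrow> (nat \<Rightarrow> 'b) \<Rightarrow> 'a set" where
  "exits_towards G F p = {v \<in> F. \<forall>N. \<exists>n\<ge>N. tail G (p n) \<notin> F \<and>
     leaving_walks G F v (tail G (p n)) \<noteq> {}}"

text \<open>\<^term>\<open>leaving_walks G F v w\<close> is the set \<open>L\<^sub>F(v, w)\<close>, \<^term>\<open>exits_towards G F p\<close> is
  \<open>[F]\<^sub>p\<close>, and \<^term>\<open>exit_class G F I\<close> below is \<open>U\<^sub>F\<^sub>;\<^sub>I\<close>.\<close>

definition exit_class :: "('a, 'b) pre_digraph \<Rightarrow> 'a set \<Rightarrow> 'a set \<Rightarrow> (nat \<Rightarrow> 'b) set" where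
  "exit_class G F I = {p \<in> wandering_paths G. exits_towards G F p = I}"

definition end_base :: "('a, 'b) pre_digraph \<Rightarrow> (nat \<Rightarrow> 'b) set set set" where
  "end_base G = {end_of G ` exit_class G F I | F I.
     finite F \<and> F \<noteq> {} \<and> F \<subseteq> verts G \<and> I \<subseteq> F}"

definition is_base_of :: "'c set set \<Rightarrow> 'c topology \<Rightarrow> bool" where
  "is_base_of \<B> X \<longleftrightarrow> openin X = arbitrary union_of (\<lambda>U. U \<in> \<B>)"

definition second_countable_space :: "'c topology \<Rightarrow> bool" where
  "second_countable_space X \<longleftrightarrow> (\<exists>\<B>. countable \<B> \<and> is_base_of \<B> X)"

text \<open>Here total disconnectedness means separation of points by clopen sets, which is in
  general stronger than requiring the connected components to be singletons.\<close>

definition totally_disconnected_space :: "'c topology \<Rightarrow> bool" where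
  "totally_disconnected_space X \<longleftrightarrow>
     (\<forall>x\<in>topspace X. \<forall>y\<in>topspace X. x \<noteq> y \<longrightarrow>
        (\<exists>U. openin X U \<and> closedin X U \<and> (x \<in> U \<longleftrightarrow> y \<notin> U)))"

end

theory Submission
  imports Defs
begin

text \<open>
  An end is determined by the family of finite data \<open>F \<mapsto> [F]\<^sub>p\<close>. One has \<open>p \<rightarrow> q\<close> if and only
  if \<open>[F]\<^sub>p \<subseteq> [F]\<^sub>q\<close> for all finite non-empty \<open>F\<close> (\<open>exits_towards_mono\<close> and its converse
  \<open>end_le_if_exits_towards_subset\<close>), so the maps \<open>\<E>(p) \<mapsto> [F]\<^sub>p\<close> are well defined and together
  embed the end space into \<open>\<Prod>\<^sub>F Pow F\<close>. This is a countable product of finite discrete spaces,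
  and the topology pulled back from it inherits metrizability and the separation of points by
  clopen sets. Second countability is clear once the base is identified, since there are only
  countably many pairs \<open>I \<subseteq> F\<close> of finite sets of vertices.

  In the pulled back topology the sets \<open>{\<E>(p). p \<in> U\<^sub>F\<^sub>;\<^sub>I}\<close> are the preimages of points under the
  coordinate maps, so a priori they only form a subbase. They form a base because for \<open>F \<subseteq> K\<close> the
  set \<open>[K]\<^sub>p\<close> determines \<open>[F]\<^sub>p\<close> (\<open>exits_towards_determined\<close>): cut a path that leaves \<open>F\<close> for good
  at its last vertex in \<open>K\<close>. Hence finitely many coordinates are controlled by a single one.
\<close>

section \<open>Topologies defined by directed families of discrete-valued maps\<close>

text \<open>
  The topology is the one induced by \<open>x \<mapsto> (f i x)\<^sub>i\<close> from the product of the discrete spaces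
  \<open>C i\<close>. The directedness assumption \<open>dir\<close> replaces the finitely many coordinates that
  occur in a basic open set of the product by one coordinate.
\<close>

lemma fibre_base_topology:
  fixes f :: "'i \<Rightarrow> 's \<Rightarrow> 'c"
  assumes I: "countable I"
    and C: "\<And>i. i \<in> I \<Longrightarrow> countable (C i)"
    and fC: "\<And>i x. i \<in> I \<Longrightarrow> x \<in> S \<Longrightarrow> f i x \<in> C i"
    and sep: "\<And>x y. x \<in> S \<Longrightarrow> y \<in> S \<Longrightarrow> x \<noteq> y \<Longrightarrow> \<exists>i\<in>I. f i x \<noteq> f i y"
    and dir: "\<And>J x. finite J \<Longrightarrow> J \<subseteq> I \<Longrightarrow> x \<in> S \<Longrightarrow>
      \<exists>k\<in>I. \<forall>j\<in>J. \<forall>y\<in>S. f k y = f k x \<longrightarrow> f j y = f j x"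
  shows "\<exists>X. topspace X = S \<and> is_base_of {{x \<in> S. f i x = c} | i c. i \<in> I \<and> c \<in> C i} X \<and>
    second_countable_space X \<and> totally_disconnected_space X \<and> metrizable_space X"
proof -
  define P where "P = product_topology (\<lambda>i. discrete_topology (C i)) I"
  define g where "g x = (\<lambda>i\<in>I. f i x)" for x
  define X where "X = pullback_topology S g P"
  let ?B = "{{x \<in> S. f i x = c} | i c. i \<in> I \<and> c \<in> C i}"
  have gP: "g x \<in> topspace P" if "x \<in> S" for x
    using that fC by (auto simp: P_def g_def)
  then have top: "topspace X = S"
    by (auto simp: X_def topspace_pullback_topology)

  have fibre_open: "openin X {x \<in> S. f i x \<in> D}" if "i \<in> I" for i D
  proof -
    have "openin P {h \<in> topspace P. h i \<in> D \<inter> C i}"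
      unfolding P_def using that
      by (intro openin_continuous_map_preimage [OF continuous_map_product_projection]) auto
    moreover have "{x \<in> S. f i x \<in> D} = g -` {h \<in> topspace P. h i \<in> D \<inter> C i} \<inter> S"
      using that gP fC by (auto simp: g_def)
    ultimately show ?thesis
      unfolding X_def openin_pullback_topology by blast
  qed

  have base: "is_base_of ?B X"
    unfolding is_base_of_def openin_topology_base_unique
  proof (intro conjI allI impI)
    fix V assume "V \<in> ?B"
    then show "openin X V"
      using fibre_open [of _ "{_}"] by auto
  next
    fix U x assume "openin X U \<and> x \<in> U"
    then obtain W where W: "openin P W" "U = g -` W \<inter> S" and x: "x \<in> S" "g x \<in> W"
      by (auto simp: X_def openin_pullback_topology)
    then obtain D where D: "finite {i \<in> I. D i \<noteq> C i}" "g x \<in> Pi\<^sub>E I D" "Pi\<^sub>E I D \<subseteq> W"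
      unfolding P_def openin_product_topology_alt by fastforce
    obtain k where k: "k \<in> I"
      "\<And>j y. j \<in> I \<Longrightarrow> D j \<noteq> C j \<Longrightarrow> y \<in> S \<Longrightarrow> f k y = f k x \<Longrightarrow> f j y = f j x"
      using dir [OF D(1) _ x(1)] by blast
    have "y \<in> U" if y: "y \<in> S" "f k y = f k x" for y
    proof -
      have "f j y \<in> D j" if j: "j \<in> I" for j
      proof (cases "D j = C j")
        case False
        then have "f j y = f j x"
          using k(2) j y by blast
        then show ?thesis
          using D(2) j by (auto simp: g_def PiE_iff)
      qed (use fC j y in simp)
      then have "g y \<in> Pi\<^sub>E I D"
        by (auto simp: g_def)
      then show ?thesis
        using D(3) W(2) y by auto
    qed
    then have "{y \<in> S. f k y = f k x} \<subseteq> U"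
      by blast
    moreover have "{y \<in> S. f k y = f k x} \<in> ?B"
      using k(1) fC x(1) by blast
    ultimately show "\<exists>V. V \<in> ?B \<and> x \<in> V \<and> V \<subseteq> U"
      using x(1) by blast
  qed

  have "?B = (\<lambda>(i, c). {x \<in> S. f i x = c}) ` (SIGMA i:I. C i)"
    by auto
  then have "countable ?B"
    using I C by simp
  then have "second_countable_space X"
    using base by (auto simp: second_countable_space_def)

  moreover have "totally_disconnected_space X"
    unfolding totally_disconnected_space_def
  proof (intro ballI impI)
    fix x y assume "x \<in> topspace X" "y \<in> topspace X" "x \<noteq> y"
    then obtain i where i: "i \<in> I" "f i x \<noteq> f i y" and xy: "x \<in> S" "y \<in> S"
      using sep top by blast
    let ?U = "{z \<in> S. f i z \<in> {f i x}}"
    have "S - ?U = {z \<in> S. f i z \<in> - {f i x}}"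
      by auto
    then have "closedin X ?U"
      using fibre_open [OF i(1), of "- {f i x}"] top by (simp add: closedin_def)
    moreover have "openin X ?U"
      by (rule fibre_open [OF i(1)])
    moreover have "x \<in> ?U" "y \<notin> ?U"
      using i(2) xy by auto
    ultimately show "\<exists>U. openin X U \<and> closedin X U \<and> (x \<in> U \<longleftrightarrow> y \<notin> U)"
      by blast
  qed

  moreover have "metrizable_space X"
  proof -
    \<comment> \<open>Separation of points makes \<open>g\<close> a homeomorphism onto a subspace of the product.\<close>
    have "inj_on g S"
    proof (rule inj_onI, rule ccontr)
      fix x y assume xy: "x \<in> S" "y \<in> S" "g x = g y" "x \<noteq> y"
      obtain i where i: "i \<in> I" "f i x \<noteq> f i y"
        using sep [OF xy(1,2,4)] by blast
      have "g x i = g y i"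
        using xy(3) by simp
      then show False
        using i by (simp add: g_def)
    qed
    then have "homeomorphic_map X (subtopology P (g ` S)) g"
    proof (intro bijective_open_imp_homeomorphic_map)
      have "continuous_map X P g"
        unfolding X_def using continuous_map_pullback [of P P id] by (simp add: comp_def)
      then show "continuous_map X (subtopology P (g ` S)) g"
        using top by (auto simp: continuous_map_in_subtopology)
      show "open_map X (subtopology P (g ` S)) g"
        unfolding open_map_def
      proof (intro allI impI)
        fix U assume "openin X U"
        then obtain W where "openin P W" "U = g -` W \<inter> S"
          by (auto simp: X_def openin_pullback_topology)
        moreover from this have "g ` U = W \<inter> g ` S"
          by auto
        ultimately show "openin (subtopology P (g ` S)) (g ` U)"
          by (auto simp: openin_subtopology)
      qed
      show "g ` topspace X = topspace (subtopology P (g ` S))"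
        using top gP by auto
    qed (simp_all add: top)
    then have "X homeomorphic_space subtopology P (g ` S)"
      by (rule homeomorphic_map_imp_homeomorphic_space)
    moreover have "metrizable_space P"
      unfolding P_def metrizable_space_product_topology
      using I by (auto intro: countable_subset [of _ I])
    ultimately show ?thesis
      by (simp add: homeomorphic_metrizable_space metrizable_space_subtopology)
  qed
  ultimately show ?thesis
    using base top by blast
qed

section \<open>Segments and splittings of paths\<close>

context wf_digraph
begin

lemma infinite_path_segment:
  assumes "p \<in> infinite_paths G" "m \<le> n"
  shows "awalk (tail G (p m)) (map p [m..<n]) (tail G (p n))"
  using assms(2)
proof (induction n rule: dec_induct)
  case base
  then show ?case
    using assms(1) by (auto simp: awalk_Nil_iff infinite_paths_def)
next
  case (step n)
  have "awalk (tail G (p n)) [p n] (tail G (p (Suc n)))"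
    using assms(1) by (auto simp: awalk_simps infinite_paths_def)
  then show ?case
    using awalk_appendI [OF step.IH] step.hyps by simp
qed

lemma infinite_path_segment_heads:
  assumes "p \<in> infinite_paths G" and "\<And>i. m < i \<Longrightarrow> tail G (p i) \<notin> K"
  shows "\<forall>e\<in>set (map p [m..<n]). head G e \<notin> K"
  using assms by (auto simp: infinite_paths_def)

lemma awalk_verts_subset_heads:
  assumes "awalk u es v"
  shows "set (awalk_verts u es) \<subseteq> insert u (head G ` set es)"
  using assms
proof (induction es arbitrary: u)
  case (Cons e es)
  then show ?case
    using Cons.IH [of "head G e"] by (auto simp: awalk_Cons_iff)
qed simp

lemma awalk_split_at_last_visit:
  assumes "awalk v es w" "v \<in> K"
  obtains es1 es2 x where "es = es1 @ es2" "awalk v es1 x" "x \<in> K" "awalk x es2 w"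
    "\<And>e. e \<in> set es2 \<Longrightarrow> head G e \<notin> K"
proof (cases "\<exists>e\<in>set es. head G e \<in> K")
  case True
  then obtain ys e zs where es: "es = ys @ e # zs" "head G e \<in> K" "\<forall>e\<in>set zs. head G e \<notin> K"
    using split_list_last_prop [of es "\<lambda>e. head G e \<in> K"] by blast
  then have "awalk v ((ys @ [e]) @ zs) w"
    using assms(1) by simp
  moreover have "awlast v (ys @ [e]) = head G e"
    by (simp add: awalk_verts_conv)
  ultimately have "awalk v (ys @ [e]) (head G e)" "awalk (head G e) zs w"
    using awalk_append_iff [of v "ys @ [e]" zs w] by metis+
  then show thesis
    using es by (intro that [of "ys @ [e]" zs "head G e"]) auto
next
  case False
  then show thesis
    using assms by (intro that [of "[]" es v]) (auto simp: awalk_Nil_iff dest: awalk_hd_in_verts)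
qed

section \<open>Exits of a wandering path\<close>

lemma wandering_path_avoids:
  assumes "p \<in> wandering_paths G" "finite H" "H \<subseteq> verts G"
  obtains N where "\<And>i. N \<le> i \<Longrightarrow> tail G (p i) \<notin> H"
  using assms unfolding wandering_paths_def by blast

lemma wandering_path_in_infinite_paths: "p \<in> wandering_paths G \<Longrightarrow> p \<in> infinite_paths G"
  by (simp add: wandering_paths_def)

lemma infinite_path_tail_in_verts: "p \<in> infinite_paths G \<Longrightarrow> tail G (p i) \<in> verts G"
  by (auto simp: infinite_paths_def)

lemma wandering_path_last_visit:
  assumes p: "p \<in> wandering_paths G"
  obtains m where "n \<le> m" "\<And>i. m < i \<Longrightarrow> tail G (p i) \<noteq> tail G (p m)"
proof -
  \<comment> \<open>Wandering relative to a single vertex says that it is visited finitely often.\<close>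
  let ?M = "{i. tail G (p i) = tail G (p n)}"
  obtain N where "\<And>i. N \<le> i \<Longrightarrow> tail G (p i) \<notin> {tail G (p n)}"
    using p by (rule wandering_path_avoids [of _ "{tail G (p n)}"])
      (use p in \<open>auto simp: wandering_path_in_infinite_paths infinite_path_tail_in_verts\<close>)
  then have "?M \<subseteq> {..<N}"
    by (auto simp: not_le [symmetric])
  then have fin: "finite ?M"
    by (rule finite_subset) simp
  then have M: "Max ?M \<in> ?M" "n \<le> Max ?M"
    by (rule Max_in, auto)
  show thesis
  proof (rule that [OF M(2)])
    fix i assume "Max ?M < i"
    then show "tail G (p i) \<noteq> tail G (p (Max ?M))"
      using M(1) Max_ge [OF fin, of i] by auto
  qed
qed

lemma exits_towardsD:
  assumes "v \<in> exits_towards G F p"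
  obtains n es where "N \<le> n" "tail G (p n) \<notin> F" "awalk v es (tail G (p n))"
    "\<forall>e\<in>set es. head G e \<notin> F"
  using assms unfolding exits_towards_def leaving_walks_def by blast

lemma exits_towardsI:
  assumes "v \<in> F"
    and "\<And>N. \<exists>n\<ge>N. \<exists>es. tail G (p n) \<notin> F \<and> awalk v es (tail G (p n)) \<and>
      (\<forall>e\<in>set es. head G e \<notin> F)"
  shows "v \<in> exits_towards G F p"
  using assms unfolding exits_towards_def leaving_walks_def by blast

text \<open>
  A path that leaves \<open>F\<close> for good and reaches \<open>p\<close> far out can be prolonged along \<open>p\<close> to a
  connection from \<open>p\<close> to \<open>q\<close> that avoids \<open>F\<close>, and along that connection to \<open>q\<close>.
\<close>

lemma exits_towards_mono:
  assumes p: "p \<in> wandering_paths G" and q: "q \<in> wandering_paths G"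
    and le: "end_le G p q" and F: "finite F" "F \<subseteq> verts G"
  shows "exits_towards G F p \<subseteq> exits_towards G F q"
proof
  fix v assume v: "v \<in> exits_towards G F p"
  show "v \<in> exits_towards G F q"
  proof (rule exits_towardsI)
    show "v \<in> F"
      using v by (simp add: exits_towards_def)
    fix N
    obtain Np where Np: "\<And>i. Np \<le> i \<Longrightarrow> tail G (p i) \<notin> F"
      using wandering_path_avoids [OF p F] by blast
    obtain Nq where Nq: "\<And>i. Nq \<le> i \<Longrightarrow> tail G (q i) \<notin> F"
      using wandering_path_avoids [OF q F] by blast
    obtain n es where n: "Np \<le> n" "tail G (p n) \<notin> F" and es: "awalk v es (tail G (p n))"
      "\<forall>e\<in>set es. head G e \<notin> F"
      by (rule exits_towardsD [OF v])
    obtain n1 n2 fs where n12: "max n (max N Nq) \<le> n1" "max n (max N Nq) \<le> n2"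
      and fs: "awalk (tail G (p n1)) fs (tail G (q n2))"
        "set (awalk_verts (tail G (p n1)) fs) \<inter> F = {}"
      using le [unfolded end_le_def, rule_format, of F "max n (max N Nq)"] F by blast
    have ip: "p \<in> infinite_paths G"
      using p by (rule wandering_path_in_infinite_paths)
    let ?seg = "map p [n..<n1]"
    have "awalk (tail G (p n)) ?seg (tail G (p n1))"
      by (rule infinite_path_segment [OF ip]) (use n12(1) in simp)
    then have "awalk v (es @ ?seg @ fs) (tail G (q n2))"
      by (intro awalk_appendI [OF es(1)] awalk_appendI [OF _ fs(1)])
    moreover have "\<forall>e\<in>set (es @ ?seg @ fs). head G e \<notin> F"
    proof -
      have "\<forall>e\<in>set ?seg. head G e \<notin> F"
        by (rule infinite_path_segment_heads [OF ip]) (use Np n(1) in simp)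
      moreover have "head G ` set fs \<subseteq> set (awalk_verts (tail G (p n1)) fs)"
        unfolding set_awalk_verts [OF fs(1)] by auto
      ultimately show ?thesis
        using es(2) fs(2) unfolding set_append by blast
    qed
    moreover have "N \<le> n2" "tail G (q n2) \<notin> F"
      using n12(2) Nq by auto
    ultimately show "\<exists>n\<ge>N. \<exists>es. tail G (q n) \<notin> F \<and> awalk v es (tail G (q n)) \<and>
        (\<forall>e\<in>set es. head G e \<notin> F)"
      by blast
  qed
qed

text \<open>
  Given \<open>H\<close> to be avoided, take a vertex \<open>v\<close> of \<open>p\<close>, visited for the last time and so late that
  \<open>p\<close> no longer meets \<open>H\<close>. The rest of \<open>p\<close> shows \<open>v \<in> [H \<union> {v}]\<^sub>p\<close>, and a path witnessing
  \<open>v \<in> [H \<union> {v}]\<^sub>q\<close> is a connection from \<open>p\<close> to \<open>q\<close> avoiding \<open>H\<close>.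
\<close>

lemma end_le_if_exits_towards_subset:
  assumes p: "p \<in> wandering_paths G"
    and sub: "\<And>F. finite F \<Longrightarrow> F \<noteq> {} \<Longrightarrow> F \<subseteq> verts G \<Longrightarrow>
      exits_towards G F p \<subseteq> exits_towards G F q"
  shows "end_le G p q"
  unfolding end_le_def
proof (intro allI impI, elim conjE)
  fix H N assume H: "finite H" "H \<subseteq> verts G"
  have ip: "p \<in> infinite_paths G"
    using p by (rule wandering_path_in_infinite_paths)
  obtain N1 where N1: "\<And>i. N1 \<le> i \<Longrightarrow> tail G (p i) \<notin> H"
    using wandering_path_avoids [OF p H] by blast
  obtain m where m: "max N N1 \<le> m" "\<And>i. m < i \<Longrightarrow> tail G (p i) \<noteq> tail G (p m)"
    using wandering_path_last_visit [OF p] by blast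
  let ?v = "tail G (p m)" and ?F = "insert (tail G (p m)) H"
  have avoid: "tail G (p i) \<notin> ?F" if "m < i" for i
    using that m N1 by auto
  have "?v \<in> exits_towards G ?F p"
  proof (rule exits_towardsI)
    fix M
    let ?n = "max M (Suc m)"
    have "awalk ?v (map p [m..<?n]) (tail G (p ?n))"
      using infinite_path_segment [OF ip] by simp
    moreover have "\<forall>e\<in>set (map p [m..<?n]). head G e \<notin> ?F"
      using ip avoid by (rule infinite_path_segment_heads)
    moreover have "tail G (p ?n) \<notin> ?F"
      by (rule avoid) simp
    ultimately show "\<exists>n\<ge>M. \<exists>es. tail G (p n) \<notin> ?F \<and> awalk ?v es (tail G (p n)) \<and>
        (\<forall>e\<in>set es. head G e \<notin> ?F)"
      by (meson max.cobounded1)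
  qed simp
  then have "?v \<in> exits_towards G ?F q"
    using sub [of ?F] H infinite_path_tail_in_verts [OF ip] by auto
  then obtain n es where n: "N \<le> n" "tail G (q n) \<notin> ?F" and es: "awalk ?v es (tail G (q n))"
    "\<forall>e\<in>set es. head G e \<notin> ?F"
    by (rule exits_towardsD)
  have "set (awalk_verts ?v es) \<inter> H = {}"
  proof -
    have "set (awalk_verts ?v es) \<subseteq> insert ?v (head G ` set es)"
      by (rule awalk_verts_subset_heads [OF es(1)])
    then show ?thesis
      using es(2) N1 m(1) by auto
  qed
  then show "\<exists>n\<^sub>1\<ge>N. \<exists>n\<^sub>2\<ge>N. \<exists>es. awalk (tail G (p n\<^sub>1)) es (tail G (q n\<^sub>2)) \<and>
      set (awalk_verts (tail G (p n\<^sub>1)) es) \<inter> H = {}"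
    using n(1) es(1) m(1) by (meson max.boundedE)
qed

text \<open>
  A path from \<open>v\<close> that leaves \<open>F\<close> for good is cut at the last vertex \<open>w\<close> it has in \<open>K\<close>. The part
  after \<open>w\<close> shows \<open>w \<in> [K]\<^sub>p\<close>, and the part before \<open>w\<close> is subject to a condition on \<open>F\<close>
  alone, so the right-hand side depends on \<open>p\<close> only through \<open>[K]\<^sub>p\<close>. Membership of \<open>w\<close> in
  \<open>[K]\<^sub>p\<close> asks for paths to arbitrarily late vertices of \<open>p\<close>; one path suffices, provided it ends
  where \<open>p\<close> no longer meets \<open>K\<close>, since it can then be prolonged along \<open>p\<close>.
\<close>

lemma exits_towards_determined:
  assumes p: "p \<in> wandering_paths G" and K: "finite K" "K \<subseteq> verts G" and FK: "F \<subseteq> K"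
  shows "exits_towards G F p =
    {v \<in> F. \<exists>w\<in>exits_towards G K p. \<exists>es. awalk v es w \<and> (\<forall>e\<in>set es. head G e \<notin> F)}"
    (is "_ = ?R")
proof (intro equalityI subsetI)
  fix v assume v: "v \<in> exits_towards G F p"
  have ip: "p \<in> infinite_paths G"
    using p by (rule wandering_path_in_infinite_paths)
  have vF: "v \<in> F"
    using v by (simp add: exits_towards_def)
  obtain N where N: "\<And>i. N \<le> i \<Longrightarrow> tail G (p i) \<notin> K"
    using wandering_path_avoids [OF p K] by blast
  obtain n es where n: "N \<le> n" "tail G (p n) \<notin> F" and es: "awalk v es (tail G (p n))"
    "\<forall>e\<in>set es. head G e \<notin> F"
    by (rule exits_towardsD [OF v])
  obtain es1 es2 w where split: "es = es1 @ es2" "awalk v es1 w" "w \<in> K"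
    "awalk w es2 (tail G (p n))" "\<And>e. e \<in> set es2 \<Longrightarrow> head G e \<notin> K"
    using awalk_split_at_last_visit [OF es(1), of K] vF FK by blast
  have "w \<in> exits_towards G K p"
  proof (rule exits_towardsI [OF split(3)])
    fix M
    let ?k = "max M n"
    have "awalk w (es2 @ map p [n..<?k]) (tail G (p ?k))"
      by (rule awalk_appendI [OF split(4) infinite_path_segment [OF ip max.cobounded2]])
    moreover have "\<forall>e\<in>set (map p [n..<?k]). head G e \<notin> K"
      by (rule infinite_path_segment_heads [OF ip]) (use N n(1) in simp)
    moreover have "tail G (p ?k) \<notin> K"
      using N n by simp
    ultimately have "tail G (p ?k) \<notin> K \<and> awalk w (es2 @ map p [n..<?k]) (tail G (p ?k)) \<and>
        (\<forall>e\<in>set (es2 @ map p [n..<?k]). head G e \<notin> K)"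
      using split(5) unfolding set_append by blast
    then show "\<exists>n\<ge>M. \<exists>es. tail G (p n) \<notin> K \<and> awalk w es (tail G (p n)) \<and>
        (\<forall>e\<in>set es. head G e \<notin> K)"
      by (meson max.cobounded1)
  qed
  then show "v \<in> ?R"
    using vF split(1,2) es(2) by auto
next
  fix v assume "v \<in> ?R"
  then obtain w es where v: "v \<in> F" and w: "w \<in> exits_towards G K p"
    and es: "awalk v es w" "\<forall>e\<in>set es. head G e \<notin> F"
    by blast
  show "v \<in> exits_towards G F p"
  proof (rule exits_towardsI [OF v])
    fix N
    obtain n fs where n: "N \<le> n" "tail G (p n) \<notin> K" and fs: "awalk w fs (tail G (p n))"
      "\<forall>e\<in>set fs. head G e \<notin> K"
      by (rule exits_towardsD [OF w])
    have "awalk v (es @ fs) (tail G (p n))"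
      using es(1) fs(1) by (rule awalk_appendI)
    then show "\<exists>n\<ge>N. \<exists>es. tail G (p n) \<notin> F \<and> awalk v es (tail G (p n)) \<and>
        (\<forall>e\<in>set es. head G e \<notin> F)"
      using n es(2) fs(2) FK by (intro exI [of _ n] conjI exI [of _ "es @ fs"]) auto
  qed
qed

section \<open>The end space\<close>

lemma end_rel_iff_exits_towards:
  "(p, q) \<in> end_rel G \<longleftrightarrow> p \<in> wandering_paths G \<and> q \<in> wandering_paths G \<and>
    (\<forall>F. finite F \<and> F \<noteq> {} \<and> F \<subseteq> verts G \<longrightarrow> exits_towards G F p = exits_towards G F q)"
proof -
  have "end_le G p q \<and> end_le G q p \<longleftrightarrow>
      (\<forall>F. finite F \<and> F \<noteq> {} \<and> F \<subseteq> verts G \<longrightarrow> exits_towards G F p = exits_towards G F q)"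
    if "p \<in> wandering_paths G" "q \<in> wandering_paths G"
  proof (intro iffI conjI allI impI)
    fix F assume "end_le G p q \<and> end_le G q p" "finite F \<and> F \<noteq> {} \<and> F \<subseteq> verts G"
    then show "exits_towards G F p = exits_towards G F q"
      using that by (intro equalityI exits_towards_mono) simp_all
  qed (use that in \<open>simp_all add: end_le_if_exits_towards_subset\<close>)
  then show ?thesis
    by (simp add: end_rel_def cong: conj_cong)
qed

lemma equiv_end_rel: "equiv (wandering_paths G) (end_rel G)"
proof (rule equivI)
  show "end_rel G \<subseteq> wandering_paths G \<times> wandering_paths G"
    by (auto simp: end_rel_def)
  show "refl_on (wandering_paths G) (end_rel G)"
    by (rule refl_onI) (simp add: end_rel_iff_exits_towards)
  show "sym (end_rel G)"
    unfolding end_rel_def by (rule symI) blast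
  show "trans (end_rel G)"
  proof (rule transI)
    fix p q r assume "(p, q) \<in> end_rel G" "(q, r) \<in> end_rel G"
    then show "(p, r) \<in> end_rel G"
      unfolding end_rel_iff_exits_towards by metis
  qed
qed

end

text \<open>
  All paths in an end have the same exits, so this union is their common value; it saves
  choosing a representative.
\<close>

definition end_exits :: "('a, 'b) pre_digraph \<Rightarrow> 'a set \<Rightarrow> (nat \<Rightarrow> 'b) set \<Rightarrow> 'a set" where
  "end_exits G F c = (\<Union>p\<in>c. exits_towards G F p)"

context wf_digraph
begin

lemma end_exits_end_of:
  assumes "p \<in> wandering_paths G" "finite F" "F \<noteq> {}" "F \<subseteq> verts G"
  shows "end_exits G F (end_of G p) = exits_towards G F p"
proof -
  have "p \<in> end_of G p"
    using assms(1) by (simp add: end_of_def end_rel_iff_exits_towards)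
  moreover have "exits_towards G F q = exits_towards G F p" if "q \<in> end_of G p" for q
    using that assms by (auto simp: end_of_def end_rel_iff_exits_towards)
  ultimately show ?thesis
    unfolding end_exits_def by blast
qed

lemma end_space_eq: "end_space G = end_of G ` wandering_paths G"
  by (auto simp: end_space_def quotient_def end_of_def)

lemma end_of_image_exit_class:
  assumes "finite F" "F \<noteq> {}" "F \<subseteq> verts G"
  shows "end_of G ` exit_class G F I = {c \<in> end_space G. end_exits G F c = I}"
proof -
  have "end_exits G F (end_of G p) = exits_towards G F p" if "p \<in> wandering_paths G" for p
    using that assms by (rule end_exits_end_of)
  then show ?thesis
    unfolding end_space_eq exit_class_def by blast
qed

lemma end_eqI:
  assumes "c \<in> end_space G" "d \<in> end_space G"
    and "\<And>F. finite F \<Longrightarrow> F \<noteq> {} \<Longrightarrow> F \<subseteq> verts G \<Longrightarrow> end_exits G F c = end_exits G F d"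
  shows "c = d"
proof -
  obtain p q where pq: "p \<in> wandering_paths G" "q \<in> wandering_paths G"
    "c = end_of G p" "d = end_of G q"
    using assms(1,2) by (auto simp: end_space_eq)
  then have "(p, q) \<in> end_rel G"
    using assms(3) by (simp add: end_rel_iff_exits_towards end_exits_end_of)
  then show ?thesis
    using equiv_class_eq [OF equiv_end_rel] pq(3,4) by (simp add: end_of_def)
qed

lemma end_exits_determined:
  assumes "c \<in> end_space G" "d \<in> end_space G" "finite K" "K \<subseteq> verts G" "F \<subseteq> K" "F \<noteq> {}"
    and "end_exits G K c = end_exits G K d"
  shows "end_exits G F c = end_exits G F d"
proof -
  obtain p q where pq: "p \<in> wandering_paths G" "q \<in> wandering_paths G"
    "c = end_of G p" "d = end_of G q"
    using assms(1,2) by (auto simp: end_space_eq)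
  have F: "finite F" "F \<subseteq> verts G" and "K \<noteq> {}"
    using assms by (auto intro: finite_subset)
  then have "exits_towards G K p = exits_towards G K q"
    using assms pq by (simp add: end_exits_end_of)
  then have "exits_towards G F p = exits_towards G F q"
    using exits_towards_determined [of _ K F] pq(1,2) assms(3-5) by simp
  then show ?thesis
    using F assms(6) pq by (simp add: end_exits_end_of)
qed

end

theorem proposition6p2:
  fixes G :: "('a, 'b) pre_digraph"
  assumes "wf_digraph G" and "countable (verts G)" and "countable (arcs G)"
  shows "\<exists>X. topspace X = end_space G \<and> is_base_of (end_base G) X \<and>
    second_countable_space X \<and> totally_disconnected_space X \<and> metrizable_space X"
proof -
  interpret wf_digraph G
    by (rule assms(1))
  define \<F> where "\<F> = {F. finite F \<and> F \<noteq> {} \<and> F \<subseteq> verts G}"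
  have fibre: "end_of G ` exit_class G F I = {c \<in> end_space G. end_exits G F c = I}"
    if "F \<in> \<F>" for F I
    using that end_of_image_exit_class by (simp add: \<F>_def)
  have "end_base G = {end_of G ` exit_class G F I | F I. F \<in> \<F> \<and> I \<in> Pow F}"
    by (simp add: end_base_def \<F>_def)
  also have "\<dots> = {{c \<in> end_space G. end_exits G F c = I} | F I. F \<in> \<F> \<and> I \<in> Pow F}"
    by (simp add: fibre cong: rev_conj_cong)
  finally have "end_base G =
      {{c \<in> end_space G. end_exits G F c = I} | F I. F \<in> \<F> \<and> I \<in> Pow F}" .
  moreover have "\<exists>X. topspace X = end_space G \<and>
      is_base_of {{c \<in> end_space G. end_exits G F c = I} | F I. F \<in> \<F> \<and> I \<in> Pow F} X \<and>
      second_countable_space X \<and> totally_disconnected_space X \<and> metrizable_space X"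
  proof (rule fibre_base_topology)
    have "\<F> \<subseteq> {F. finite F \<and> F \<subseteq> verts G}"
      by (auto simp: \<F>_def)
    then show "countable \<F>"
      using countable_Collect_finite_subset [OF assms(2)] countable_subset by blast
  next
    fix F assume "F \<in> \<F>"
    then show "countable (Pow F)"
      by (simp add: \<F>_def countable_finite)
  next
    fix F c show "end_exits G F c \<in> Pow F"
      by (auto simp: end_exits_def exits_towards_def)
  next
    fix c d assume "c \<in> end_space G" "d \<in> end_space G" "c \<noteq> d"
    then show "\<exists>F\<in>\<F>. end_exits G F c \<noteq> end_exits G F d"
      using end_eqI [of c d] by (auto simp: \<F>_def)
  next
    fix J c assume J: "finite J" "J \<subseteq> \<F>" and c: "c \<in> end_space G"
    then obtain p where "p \<in> wandering_paths G"
      by (auto simp: end_space_eq)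
    then have v: "tail G (p 0) \<in> verts G"
      by (simp add: wandering_path_in_infinite_paths infinite_path_tail_in_verts)
    \<comment> \<open>The extra vertex makes \<open>K\<close> non-empty when \<open>J\<close> is empty.\<close>
    let ?K = "insert (tail G (p 0)) (\<Union>J)"
    have K: "finite ?K" "?K \<subseteq> verts G"
      using J v by (auto simp: \<F>_def)
    have "end_exits G F d = end_exits G F c"
      if "F \<in> J" "d \<in> end_space G" "end_exits G ?K d = end_exits G ?K c" for F d
    proof (rule end_exits_determined [OF that(2) c K _ _ that(3)])
      show "F \<subseteq> ?K" "F \<noteq> {}"
        using that(1) J(2) by (auto simp: \<F>_def)
    qed
    moreover have "?K \<in> \<F>"
      using K by (simp add: \<F>_def)
    ultimately show "\<exists>K\<in>\<F>. \<forall>F\<in>J. \<forall>d\<in>end_space G.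
        end_exits G K d = end_exits G K c \<longrightarrow> end_exits G F d = end_exits G F c"
      by blast
  qed
  ultimately show ?thesis
    by simp
qed

end
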